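(* Let $m\geq 3$ be an integer and let $\boldsymbol{E}_m\in\mathbb{R}^{m\times 2}$ be the matrix whose $j$-th row is $\left(\cos\frac{(j-1)\pi}{m},\ \sin\frac{(j-1)\pi}{m}\right)$, $j=1,\ldots,m$. Then $$\beta_{\boldsymbol{E}_m}=\begin{cases}\dfrac{1}{\sqrt{1-\frac{2}{m\cdot\sin\frac{\pi}{m}}}} & \text{if $m$ is even},\\[3ex] \dfrac{1}{\sqrt{1-\frac{1}{m\cdot\sin\frac{\pi}{2m}}}} & \text{if $m$ is odd}.\end{cases}$$
   Context: For $\boldsymbol{x},\boldsymbol{y}\in\mathbb{R}^d$ set $\mathrm{dist}(\boldsymbol{x},\boldsymbol{y}):=\min\{\|\boldsymbol{x}-\boldsymbol{y}\|_2,\|\boldsymbol{x}+\boldsymbol{y}\|_2\}$. For $\boldsymbol{A}\in\mathbb{R}^{m\times d}$, $|\boldsymbol{A}\boldsymbol{x}|\in\mathbb{R}_+^m$ denotes the vector of entrywise absolute values of $\boldsymbol{A}\boldsymbol{x}$. Define $$L_{\boldsymbol{A}}:=\inf_{\boldsymbol{x},\boldsymbol{y}\in\mathbb{R}^d,\ \mathrm{dist}(\boldsymbol{x},\boldsymbol{y})\neq 0}\frac{\||\boldsymbol{A}\boldsymbol{x}|-|\boldsymbol{A}\boldsymbol{y}|\|_2}{\mathrm{dist}(\boldsymbol{x},\boldsymbol{y})},\qquad U_{\boldsymbol{A}}:=\sup_{\boldsymbol{x},\boldsymbol{y}\in\mathbb{R}^d,\ \mathrm{dist}(\boldsymbol{x},\boldsymbol{y})\neq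 0}\frac{\||\boldsymbol{A}\boldsymbol{x}|-|\boldsymbol{A}\boldsymbol{y}|\|_2}{\mathrm{dist}(\boldsymbol{x},\boldsymbol{y})}.$$ The condition number is $\beta_{\boldsymbol{A}}:=U_{\boldsymbol{A}}/L_{\boldsymbol{A}}$, with the convention $\beta_{\boldsymbol{A}}=+\infty$ if $L_{\boldsymbol{A}}=0$. *)

theory Defs
  imports "HOL-Analysis.Analysis"
begin

definition sgn_dist :: "real ^ 'd \<Rightarrow> real ^ 'd \<Rightarrow> real" where
  "sgn_dist x y = min (norm (x - y)) (norm (x + y))"

text \<open>The absolute value on \<open>real ^ 'm\<close> is the entrywise one (\<open>abs_vec_def\<close>).\<close>

definition pr_ratios :: "real ^ 'd ^ 'm \<Rightarrow> real set" where
  "pr_ratios A = {norm (\<bar>A *v x\<bar> - \<bar>A *v y\<bar>) / sgn_dist x y | x y. sgn_dist x y \<noteq> 0}"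

definition pr_lower :: "real ^ 'd ^ 'm \<Rightarrow> real" where
  "pr_lower A = Inf (pr_ratios A)"

definition pr_upper :: "real ^ 'd ^ 'm \<Rightarrow> real" where
  "pr_upper A = Sup (pr_ratios A)"

text \<open>The infimum and supremum above are genuine: the set of ratios is nonempty and bounded.\<close>

lemma sgn_dist_nonneg: "0 \<le> sgn_dist x y"
  by (simp add: sgn_dist_def)

lemma pr_ratios_nonempty: "pr_ratios (A :: real ^ 'd ^ 'm) \<noteq> {}"
proof -
  obtain b :: "real ^ 'd" where "b \<in> Basis" using nonempty_Basis by blast
  then have "sgn_dist b 0 \<noteq> 0" by (simp add: sgn_dist_def)
  then show ?thesis unfolding pr_ratios_def by blast
qed

lemma bdd_below_pr_ratios: "bdd_below (pr_ratios A)"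
  by (rule bdd_belowI[of _ 0]) (auto simp: pr_ratios_def sgn_dist_nonneg)

lemma bdd_above_pr_ratios: "bdd_above (pr_ratios (A :: real ^ 'd ^ 'm))"
proof (rule bdd_aboveI)
  fix r assume "r \<in> pr_ratios A"
  then obtain x y where r: "r = norm (\<bar>A *v x\<bar> - \<bar>A *v y\<bar>) / sgn_dist x y"
    and nz: "sgn_dist x y \<noteq> 0" unfolding pr_ratios_def by blast
  have lin: "bounded_linear ((*v) A)" by (rule matrix_vector_mul_bounded_linear)
  have minus: "norm (\<bar>A *v x\<bar> - \<bar>A *v y\<bar>) \<le> norm (A *v (x - y))"
    unfolding matrix_vector_mult_diff_distrib
    by (rule norm_le_componentwise_cart)
      (simp only: abs_vec_def vector_minus_component vec_lambda_beta real_norm_def abs_triangle_ineq3)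
  have plus: "norm (\<bar>A *v x\<bar> - \<bar>A *v y\<bar>) \<le> norm (A *v (x + y))"
    unfolding matrix_vector_right_distrib
    by (rule norm_le_componentwise_cart)
      (simp only: abs_vec_def vector_minus_component vector_add_component vec_lambda_beta
        real_norm_def)
  have "norm (\<bar>A *v x\<bar> - \<bar>A *v y\<bar>) \<le> onorm ((*v) A) * sgn_dist x y"
  proof (cases "norm (x - y) \<le> norm (x + y)")
    case True
    then have "sgn_dist x y = norm (x - y)" by (simp only: sgn_dist_def min_def if_True)
    then show ?thesis using order_trans[OF minus onorm[OF lin, of "x - y"]] by (simp only:)
  next
    case False
    then have "sgn_dist x y = norm (x + y)" by (simp only: sgn_dist_def min_def if_False)
    then show ?thesis using order_trans[OF plus onorm[OF lin, of "x + y"]] by (simp only:)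
  qed
  moreover have "0 < sgn_dist x y" using nz sgn_dist_nonneg[of x y] by linarith
  ultimately show "r \<le> onorm ((*v) A)" unfolding r by (simp only: pos_divide_le_eq)
qed

definition cond_number :: "real ^ 'd ^ 'm \<Rightarrow> ereal" where
  "cond_number A = (if pr_lower A = 0 then \<infinity> else ereal (pr_upper A / pr_lower A))"

text \<open>The type \<open>'m\<close> indexing the rows carries no order, so \<open>pos\<close>, a bijection onto
  \<open>{1..CARD('m)}\<close> when used, says that row \<open>i\<close> is the \<open>pos i\<close>-th one.\<close>

definition harmonic_frame :: "('m \<Rightarrow> nat) \<Rightarrow> real ^ 2 ^ 'm" where
  "harmonic_frame pos = (\<chi> i. vector
     [cos ((real (pos i) - 1) * pi / real CARD('m)),
      sin ((real (pos i) - 1) * pi / real CARD('m))])"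

end

theory Submission
  imports Defs
begin

text \<open>With \<open>u = x + y\<close> and \<open>v = x - y\<close> one has
  \<open>(\<bar>a \<bullet> x\<bar> - \<bar>a \<bullet> y\<bar>)\<^sup>2 = min ((a \<bullet> u)\<^sup>2) ((a \<bullet> v)\<^sup>2)\<close>, and the distance of \<open>x\<close> and \<open>y\<close> is
  \<open>min \<parallel>u\<parallel> \<parallel>v\<parallel>\<close>. Since the rows form a tight frame with constant \<open>m / 2\<close>, the upper constant
  is \<open>sqrt (m / 2)\<close>. For the lower constant it suffices to take unit vectors \<open>u\<close>, \<open>v\<close> at angles
  \<open>s\<close>, \<open>t\<close>; writing the minimum through an absolute value turns the sum into
  \<open>(m - \<bar>sin (s - t)\<bar> * (\<Sum>j. \<bar>sin (2 * pi * j / m - s - t)\<bar>)) / 2\<close>. The remaining sum of absolute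
  sines runs over equidistant points modulo \<open>pi\<close> (\<open>m\<close> of them for odd \<open>m\<close>, \<open>m / 2\<close> of them, each
  taken twice, for even \<open>m\<close>), so its maximum is given by a telescoping sum.\<close>

section \<open>Closed forms for trigonometric sums over arithmetic progressions\<close>

lemma sum_sin_arith_progression:
  fixes h c :: real
  shows "2 * sin h * (\<Sum>j<n. sin (2 * h * real j + c)) = cos (c - h) - cos (2 * h * real n + c - h)"
proof (induction n)
  case (Suc n)
  \<comment> \<open>Product-to-sum makes each summand a difference of cosines half a step to either
    side, so the sum telescopes.\<close>
  have "2 * sin h * sin (2 * h * real n + c)
      = cos ((2 * h * real n + c) - h) - cos ((2 * h * real n + c) + h)"
    by (simp add: cos_add cos_diff)
  also have "(2 * h * real n + c) + h = 2 * h * real (Suc n) + c - h"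
    by (simp add: algebra_simps)
  finally show ?case using Suc by (simp add: distrib_left)
qed simp

text \<open>A phase shift by \<open>pi / 2\<close> turns cosines into sines; the boundary terms of
  the telescoped sum then differ by a full turn and cancel. \<open>2 \<le> m\<close> makes
  \<open>sin (pi / m)\<close> positive, so it can be divided out.\<close>

lemma sum_cos_regular_polygon:
  assumes "2 \<le> m"
  shows "(\<Sum>j<m. cos (2 * pi * real j / real m + c)) = 0"
proof -
  let ?h = "pi / real m"
  have "0 < sin ?h"
    using assms by (intro sin_gt_zero) (auto simp: field_simps)
  moreover have "2 * sin ?h * (\<Sum>j<m. sin (2 * ?h * real j + (c + pi / 2))) = 0"
  proof -
    have "cos (2 * ?h * real m + (c + pi / 2) - ?h) = cos ((c + pi / 2 - ?h) + 2 * pi)"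
      using assms by (intro arg_cong[of _ _ cos]) simp
    then show ?thesis unfolding sum_sin_arith_progression by (simp only: cos_periodic)
  qed
  moreover have "sin (2 * ?h * real j + (c + pi / 2)) = cos (2 * pi * real j / real m + c)" for j
    by (simp add: sin_add add.assoc[symmetric])
  ultimately show ?thesis by simp
qed

section \<open>Sums of absolute sines at equidistant points\<close>

lemma sum_periodic_shift:
  fixes f :: "int \<Rightarrow> real"
  assumes "\<And>k. f (k + int n) = f k"
  shows "(\<Sum>j<n. f (int j + q)) = (\<Sum>j<n. f (int j))"
proof -
  \<comment> \<open>Shifting by one drops \<open>f q\<close> and adds \<open>f (q + n)\<close>,
    which are equal.\<close>
  have step: "(\<Sum>j<n. f (int j + (q + 1))) = (\<Sum>j<n. f (int j + q))" for q
  proof -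
    have "(\<Sum>j<Suc n. f (int j + q)) = f q + (\<Sum>j<n. f (int j + (q + 1)))"
      by (subst sum.lessThan_Suc_shift) (simp add: algebra_simps)
    moreover have "(\<Sum>j<Suc n. f (int j + q)) = (\<Sum>j<n. f (int j + q)) + f q"
      using assms[of q] by (simp add: add.commute)
    ultimately show ?thesis by simp
  qed
  show ?thesis
  proof (induction q rule: int_induct[where k = 0])
    case (step2 i)
    then show ?case using step[of "i - 1"] by simp
  qed (simp_all add: step)
qed

lemma abs_sin_add_pi_nat: "\<bar>sin (x + pi * real k)\<bar> = \<bar>sin x\<bar>"
proof (induction k)
  case (Suc k)
  have "x + pi * real (Suc k) = (x + pi * real k) + pi"
    by (simp add: distrib_left)
  then show ?case using Suc by (simp only: sin_periodic_pi abs_minus)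
qed simp

text \<open>Shifting \<open>c\<close> by multiples of \<open>pi / n\<close> permutes the summands,
  so \<open>c\<close> may be reduced to a remainder \<open>d\<close> between 0 and
  \<open>pi / n\<close>. Then all sines are nonnegative, and the telescoped sum is a difference of
  two cosines, hence at most 2.\<close>

lemma sum_abs_sin_le:
  assumes "1 \<le> n"
  shows "(\<Sum>j<n. \<bar>sin (pi * real j / real n + c)\<bar>) \<le> 1 / sin (pi / (2 * real n))"
proof -
  let ?h = "pi / (2 * real n)"
  define q where "q = \<lfloor>c * real n / pi\<rfloor>"
  define d where "d = c - pi * real_of_int q / real n"
  have n: "0 < real n" using assms by simp
  have "real_of_int q \<le> c * real n / pi" "c * real n / pi < real_of_int q + 1"
    unfolding q_def by linarith+
  then have "pi * real_of_int q / real n \<le> c" "c < pi * (real_of_int q + 1) / real n"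
    using n by (simp_all add: field_simps)
  then have d: "0 \<le> d" "d \<le> pi / real n"
    by (simp_all add: d_def distrib_left add_divide_distrib)
  \<comment> \<open>Integer indices, since \<open>q\<close> may be negative.\<close>
  define f where "f k = \<bar>sin (pi * real_of_int k / real n + d)\<bar>" for k
  have per: "f (k + int n) = f k" for k
  proof -
    have "pi * real_of_int (k + int n) / real n + d = (pi * real_of_int k / real n + d) + pi"
      using n by (simp add: field_simps)
    then show ?thesis unfolding f_def by (simp only: sin_periodic_pi abs_minus)
  qed
  have "(\<Sum>j<n. \<bar>sin (pi * real j / real n + c)\<bar>) = (\<Sum>j<n. f (int j + q))"
    by (simp add: f_def d_def add_divide_distrib algebra_simps)
  also have "\<dots> = (\<Sum>j<n. f (int j))"
    using per by (rule sum_periodic_shift)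
  also have "\<dots> = (\<Sum>j<n. sin (2 * ?h * real j + d))"
  proof (intro sum.cong refl)
    fix j assume "j \<in> {..<n}"
    then have "real j + 1 \<le> real n" by simp
    then have "pi * ((real j + 1) / real n) \<le> pi * 1"
      using n by (intro mult_left_mono) auto
    then have "pi * real j / real n + d \<le> pi"
      using d by (simp add: distrib_left add_divide_distrib)
    then have "0 \<le> sin (pi * real j / real n + d)"
      using d by (intro sin_ge_zero) auto
    then show "f (int j) = sin (2 * ?h * real j + d)"
      by (simp add: f_def)
  qed
  finally have eq: "(\<Sum>j<n. \<bar>sin (pi * real j / real n + c)\<bar>) = (\<Sum>j<n. sin (2 * ?h * real j + d))" .
  have "2 * sin ?h * (\<Sum>j<n. sin (2 * ?h * real j + d)) \<le> 2"
    unfolding sum_sin_arith_progression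
    using cos_le_one[of "d - ?h"] cos_ge_minus_one[of "2 * ?h * real n + d - ?h"] by linarith
  moreover have "0 < sin ?h"
    using assms by (intro sin_gt_zero) (auto simp: field_simps)
  ultimately show ?thesis unfolding eq by (simp add: field_simps)
qed

text \<open>The equality case of \<open>sum_abs_sin_le\<close>: for a phase of half a step the
  boundary cosines are \<open>cos 0\<close> and \<open>cos pi\<close>, whose difference is exactly
  2.\<close>

lemma sum_abs_sin_midpoints:
  assumes "1 \<le> n"
  shows "(\<Sum>j<n. \<bar>sin (pi * real j / real n + pi / (2 * real n))\<bar>) = 1 / sin (pi / (2 * real n))"
proof -
  let ?h = "pi / (2 * real n)"
  have n: "0 < real n" using assms by simp
  have "\<bar>sin (pi * real j / real n + ?h)\<bar> = sin (2 * ?h * real j + ?h)" if "j < n" for j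
  proof -
    have "2 * real j + 1 \<le> 2 * real n" using that by linarith
    then have "pi * ((2 * real j + 1) / (2 * real n)) \<le> pi * 1"
      using n by (intro mult_left_mono) auto
    then have "pi * real j / real n + ?h \<le> pi"
      by (simp add: distrib_left add_divide_distrib)
    then have "0 \<le> sin (pi * real j / real n + ?h)"
      by (intro sin_ge_zero) auto
    then show ?thesis by simp
  qed
  then have eq: "(\<Sum>j<n. \<bar>sin (pi * real j / real n + ?h)\<bar>) = (\<Sum>j<n. sin (2 * ?h * real j + ?h))"
    by (intro sum.cong) auto
  have "2 * ?h * real n = pi" using n by simp
  then have "2 * sin ?h * (\<Sum>j<n. sin (2 * ?h * real j + ?h)) = 2"
    unfolding sum_sin_arith_progression by simp
  moreover have "0 < sin ?h"
    using assms by (intro sin_gt_zero) (auto simp: field_simps)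
  ultimately show ?thesis unfolding eq by (simp add: field_simps)
qed

text \<open>By \<open>sum_abs_sin_midpoints\<close> the left side is a sum of \<open>n\<close> terms
  bounded by 1, the first of which is strictly smaller. This later keeps the lower constant
  positive.\<close>

lemma inverse_sin_lt:
  assumes "2 \<le> n"
  shows "1 / sin (pi / (2 * real n)) < real n"
proof -
  have "\<bar>sin (pi / (2 * real n))\<bar> < 1"
  proof -
    have "- (pi / 2) \<le> 0" "0 \<le> pi / (2 * real n)" "pi / (2 * real n) < pi / 2"
      using assms by (auto simp: field_simps)
    then have "sin (pi / (2 * real n)) < sin (pi / 2)"
      by (intro sin_monotone_2pi) linarith+
    moreover have "0 \<le> sin (pi / (2 * real n))"
      using assms by (intro sin_ge_zero) (auto simp: field_simps)
    ultimately show ?thesis by simp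
  qed
  then have "(\<Sum>j<n. \<bar>sin (pi * real j / real n + pi / (2 * real n))\<bar>) < (\<Sum>j<n. 1)"
    using assms by (intro sum_strict_mono_ex1) (auto intro!: bexI[of _ 0])
  then show ?thesis
    using assms by (simp add: sum_abs_sin_midpoints)
qed

text \<open>Doubling permutes the residues modulo an odd \<open>m\<close>, and reducing
  \<open>2 * j\<close> modulo \<open>m\<close> changes the angle by a multiple of \<open>pi\<close>,
  which the absolute sine does not see.\<close>

lemma sum_abs_sin_double_odd:
  assumes "odd m"
  shows "(\<Sum>j<m. \<bar>sin (2 * pi * real j / real m + c)\<bar>) = (\<Sum>j<m. \<bar>sin (pi * real j / real m + c)\<bar>)"
proof -
  have m: "0 < m" using assms by (auto intro: Nat.gr0I)
  define g where "g j = (2 * j) mod m" for j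
  have "inj_on g {..<m}"
  proof (rule inj_onI)
    fix i j assume ij: "i \<in> {..<m}" "j \<in> {..<m}" "g i = g j"
    then have "(2 * int i) mod int m = (2 * int j) mod int m"
      unfolding g_def by (metis of_nat_mult of_nat_numeral zmod_int)
    then have "int m dvd 2 * (int i - int j)"
      by (simp add: mod_eq_dvd_iff right_diff_distrib)
    moreover have "coprime (int m) 2" using assms by simp
    ultimately have "int m dvd int i - int j"
      using coprime_dvd_mult_right_iff by blast
    then have "int i mod int m = int j mod int m" by (simp add: mod_eq_dvd_iff)
    then show "i = j" using ij by simp
  qed
  moreover have "g ` {..<m} \<subseteq> {..<m}" using m by (auto simp: g_def)
  ultimately have bij: "bij_betw g {..<m} {..<m}"
    by (simp add: bij_betw_def endo_inj_surj)
  have "\<bar>sin (2 * pi * real j / real m + c)\<bar> = \<bar>sin (pi * real (g j) / real m + c)\<bar>" for j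
  proof -
    have "real (2 * j) = real (g j) + real m * real (2 * j div m)"
      unfolding g_def by (metis mod_mult_div_eq of_nat_add of_nat_mult)
    then have "2 * pi * real j = pi * (real (g j) + real m * real (2 * j div m))"
      by simp
    then have "2 * pi * real j / real m + c
        = (pi * real (g j) / real m + c) + pi * real (2 * j div m)"
      using m by (simp add: field_simps)
    then show ?thesis by (simp only: abs_sin_add_pi_nat)
  qed
  then show ?thesis
    by (simp only: sum.reindex_bij_betw[OF bij, of "\<lambda>j. \<bar>sin (pi * real j / real m + c)\<bar>"])
qed

text \<open>The angles for \<open>j\<close> and \<open>j + n\<close> differ by \<open>pi\<close>, so
  every value occurs twice.\<close>

lemma sum_abs_sin_double_even:
  assumes "1 \<le> n"
  shows "(\<Sum>j<2 * n. \<bar>sin (2 * pi * real j / real (2 * n) + c)\<bar>)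
    = 2 * (\<Sum>j<n. \<bar>sin (pi * real j / real n + c)\<bar>)"
proof -
  let ?f = "\<lambda>j. \<bar>sin (pi * real j / real n + c)\<bar>"
  have "?f (j + n) = ?f j" for j
  proof -
    have "pi * real (j + n) / real n + c = (pi * real j / real n + c) + pi"
      using assms by (simp add: field_simps)
    then show ?thesis by (simp only: sin_periodic_pi abs_minus)
  qed
  then have "(\<Sum>j<n. ?f (j + n)) = sum ?f {..<n}"
    by (intro sum.cong refl)
  moreover have "sum ?f {..<n + k} = sum ?f {..<n} + (\<Sum>j<k. ?f (j + n))" for k
    by (induction k) (simp_all add: add.commute)
  moreover have "2 * pi * real j / real (2 * n) = pi * real j / real n" for j
    by simp
  ultimately show ?thesis by (simp only: mult_2)
qed

section \<open>Sums of squared cosines and of their minima\<close>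

lemma sum_min_cos_squared:
  assumes "2 \<le> m"
  shows "(\<Sum>j<m. min ((cos (pi * real j / real m - s))\<^sup>2) ((cos (pi * real j / real m - t))\<^sup>2))
    = (real m - \<bar>sin (s - t)\<bar> * (\<Sum>j<m. \<bar>sin (2 * pi * real j / real m + (- s - t))\<bar>)) / 2"
proof -
  let ?a = "\<lambda>j. 2 * pi * real j / real m"
  have "min ((cos (pi * real j / real m - s))\<^sup>2) ((cos (pi * real j / real m - t))\<^sup>2)
      = 1 / 2 + (cos (?a j + - 2 * s) + cos (?a j + - 2 * t)) / 4
        - \<bar>sin (s - t)\<bar> * \<bar>sin (?a j + (- s - t))\<bar> / 2" for j
  proof -
    let ?w = "pi * real j / real m"
    have sq: "(cos (?w - r))\<^sup>2 = 1 / 2 + cos (?a j + - 2 * r) / 2" for r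
      using cos_double_cos[of "?w - r"] by (simp add: right_diff_distrib field_simps)
    \<comment> \<open>The two angles lie symmetrically about \<open>?a j - s - t\<close>, so the
      difference of their cosines is a product of sines.\<close>
    have "cos (?a j + - 2 * s) = cos ((?a j + (- s - t)) - (s - t))"
      "cos (?a j + - 2 * t) = cos ((?a j + (- s - t)) + (s - t))"
      by (simp_all add: algebra_simps)
    then have "cos (?a j + - 2 * s) - cos (?a j + - 2 * t)
        = 2 * (sin (s - t) * sin (?a j + (- s - t)))"
      by (simp only: cos_diff[of "?a j + (- s - t)" "s - t"] cos_add[of "?a j + (- s - t)" "s - t"])
        (simp add: algebra_simps)
    then have "\<bar>cos (?a j + - 2 * s) - cos (?a j + - 2 * t)\<bar>
        = 2 * (\<bar>sin (s - t)\<bar> * \<bar>sin (?a j + (- s - t))\<bar>)"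
      by (simp only: abs_mult)
    \<comment> \<open>The minimum is the mean minus half the absolute difference.\<close>
    moreover have "min (1 / 2 + p / 2) (1 / 2 + q / 2) = 1 / 2 + (p + q) / 4 - \<bar>p - q\<bar> / 4"
      for p q :: real
      by (simp add: min_def abs_if field_simps)
    ultimately show ?thesis unfolding sq by simp
  qed
  \<comment> \<open>The cosines sum to zero; only the constants and the absolute sines
    survive.\<close>
  then show ?thesis
    using assms
    by (simp only: sum_subtractf sum.distrib sum_divide_distrib[symmetric]
        sum_distrib_left[symmetric] sum_cos_regular_polygon) (simp add: diff_divide_distrib)
qed

text \<open>The tight frame identity: for \<open>s = t\<close> the sine factor vanishes.\<close>

lemma sum_cos_squared:
  assumes "2 \<le> m"
  shows "(\<Sum>j<m. (cos (pi * real j / real m - s))\<^sup>2) = real m / 2"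
  using sum_min_cos_squared[OF assms, of s s] by simp

section \<open>From vectors to angles, and the condition number\<close>

lemma polar_vec2:
  fixes w :: "real ^ 2"
  obtains s where "w $ 1 = norm w * cos s" "w $ 2 = norm w * sin s"
proof -
  have "w $ 1 = Re (Complex (w $ 1) (w $ 2))" "w $ 2 = Im (Complex (w $ 1) (w $ 2))"
    by simp_all
  moreover have "cmod (Complex (w $ 1) (w $ 2)) = norm w"
    by (simp add: norm_vec_def L2_set_def sum_2 complex_norm)
  ultimately show ?thesis
    using that rcis_cmod_Arg[of "Complex (w $ 1) (w $ 2)"] by (metis Re_rcis Im_rcis)
qed

text \<open>The sign of \<open>p * q\<close> decides which of the two squares is smaller, and the
  left side is \<open>p\<^sup>2 + q\<^sup>2 - 2 * \<bar>p * q\<bar>\<close>.\<close>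

lemma abs_diff_squared: "(\<bar>p\<bar> - \<bar>q\<bar>)\<^sup>2 = min ((p + q)\<^sup>2) ((p - q)\<^sup>2)" for p q :: real
proof -
  have "(p + q)\<^sup>2 - (p - q)\<^sup>2 = 4 * (p * q)" by (simp add: power2_eq_square algebra_simps)
  moreover have "(\<bar>p\<bar> - \<bar>q\<bar>)\<^sup>2 = p\<^sup>2 + q\<^sup>2 - 2 * \<bar>p * q\<bar>"
    by (simp add: power2_diff abs_mult)
  ultimately show ?thesis
    by (simp add: min_def power2_sum power2_diff abs_if)
qed

lemma harmonic_frame_norm_squared:
  fixes pos :: "'m::finite \<Rightarrow> nat"
  assumes m: "CARD('m) = m" and bij: "bij_betw pos UNIV {1..m}"
    and u: "(x + y) $ 1 = a * cos s" "(x + y) $ 2 = a * sin s"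
    and v: "(x - y) $ 1 = b * cos t" "(x - y) $ 2 = b * sin t"
  shows "(norm (\<bar>harmonic_frame pos *v x\<bar> - \<bar>harmonic_frame pos *v y\<bar>))\<^sup>2
    = (\<Sum>j<m. min (a\<^sup>2 * (cos (pi * real j / real m - s))\<^sup>2)
                   (b\<^sup>2 * (cos (pi * real j / real m - t))\<^sup>2))"
proof -
  let ?A = "harmonic_frame pos"
  let ?th = "\<lambda>k. (real k - 1) * pi / real m"
  let ?g = "\<lambda>k. min (a\<^sup>2 * (cos (?th k - s))\<^sup>2) (b\<^sup>2 * (cos (?th k - t))\<^sup>2)"
  have row: "(?A *v z) $ i = cos (?th (pos i)) * z $ 1 + sin (?th (pos i)) * z $ 2" for z i
    by (simp add: harmonic_frame_def matrix_vector_mult_def sum_2 m)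
  have polar: "(?A *v z) $ i = r * cos (?th (pos i) - p)"
    if "z $ 1 = r * cos p" "z $ 2 = r * sin p" for z r p i
    by (simp add: row that cos_diff algebra_simps)
  have "(norm (\<bar>?A *v x\<bar> - \<bar>?A *v y\<bar>))\<^sup>2 = (\<Sum>i\<in>UNIV. (\<bar>(?A *v x) $ i\<bar> - \<bar>(?A *v y) $ i\<bar>)\<^sup>2)"
    by (simp add: norm_vec_def L2_set_def sum_nonneg abs_vec_def)
  also have "\<dots> = (\<Sum>i\<in>UNIV. ?g (pos i))"
  proof (intro sum.cong refl)
    fix i
    have "(?A *v x) $ i + (?A *v y) $ i = a * cos (?th (pos i) - s)"
      using polar[OF u, of i] by (simp add: matrix_vector_right_distrib)
    moreover have "(?A *v x) $ i - (?A *v y) $ i = b * cos (?th (pos i) - t)"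
      using polar[OF v, of i] by (simp add: matrix_vector_mult_diff_distrib)
    ultimately show "(\<bar>(?A *v x) $ i\<bar> - \<bar>(?A *v y) $ i\<bar>)\<^sup>2 = ?g (pos i)"
      by (simp add: abs_diff_squared power_mult_distrib)
  qed
  also have "\<dots> = (\<Sum>k\<in>{1..m}. ?g k)"
    using bij by (rule sum.reindex_bij_betw)
  \<comment> \<open>Positions start at 1, so \<open>k = Suc j\<close> absorbs the \<open>- 1\<close>
    in the row angle.\<close>
  also have "\<dots> = (\<Sum>j<m. ?g (Suc j))"
    by (simp add: sum.atLeast1_atMost_eq)
  finally show ?thesis by (simp add: mult.commute)
qed

text \<open>Isolates what depends on the parity of \<open>m\<close>: \<open>M\<close> is the maximum
  over all phases of the sum of absolute sines, attained at \<open>c\<close>. The extreme ratios are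
  \<open>sqrt (m / 2)\<close> and \<open>sqrt ((m - M) / 2)\<close>, the latter positive as
  \<open>M < m\<close>.\<close>

lemma cond_number_harmonic_frame:
  fixes pos :: "'m::finite \<Rightarrow> nat"
  assumes m2: "2 \<le> m" and m: "CARD('m) = m" and bij: "bij_betw pos UNIV {1..m}"
    and le: "\<And>c. (\<Sum>j<m. \<bar>sin (2 * pi * real j / real m + c)\<bar>) \<le> M"
    and eq: "(\<Sum>j<m. \<bar>sin (2 * pi * real j / real m + c)\<bar>) = M"
    and less: "M < real m"
  shows "cond_number (harmonic_frame pos) = ereal (1 / sqrt (1 - M / real m))"
proof -
  let ?A = "harmonic_frame pos"
  let ?N = "\<lambda>x y. norm (\<bar>?A *v x\<bar> - \<bar>?A *v y\<bar>)"
  let ?L = "sqrt ((real m - M) / 2)" and ?U = "sqrt (real m / 2)"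
  note nsq = harmonic_frame_norm_squared[OF m bij]
  have M0: "0 \<le> M" unfolding eq[symmetric] by (intro sum_nonneg) simp
  have bounds: "?L \<le> ?N x y / sgn_dist x y \<and> ?N x y / sgn_dist x y \<le> ?U"
    if nz: "sgn_dist x y \<noteq> 0" for x y
  proof -
    obtain s where s: "(x + y) $ 1 = norm (x + y) * cos s" "(x + y) $ 2 = norm (x + y) * sin s"
      by (rule polar_vec2)
    obtain t where t: "(x - y) $ 1 = norm (x - y) * cos t" "(x - y) $ 2 = norm (x - y) * sin t"
      by (rule polar_vec2)
    define r where "r = sgn_dist x y"
    have r: "0 < r" "r \<le> norm (x + y)" "r \<le> norm (x - y)"
      using nz sgn_dist_nonneg[of x y] by (auto simp: r_def sgn_dist_def)
    let ?cs = "\<lambda>p j. (cos (pi * real j / real m - p))\<^sup>2"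
    have N: "(?N x y)\<^sup>2 = (\<Sum>j<m. min ((norm (x + y))\<^sup>2 * ?cs s j) ((norm (x - y))\<^sup>2 * ?cs t j))"
      by (rule nsq[OF s t])
    \<comment> \<open>Lowering both norms to \<open>r\<close> only decreases the minima, so the
      lower bound reduces to unit vectors.\<close>
    have "r\<^sup>2 * ((real m - M) / 2) \<le> r\<^sup>2 * (\<Sum>j<m. min (?cs s j) (?cs t j))"
    proof -
      have "\<bar>sin (s - t)\<bar> * (\<Sum>j<m. \<bar>sin (2 * pi * real j / real m + (- s - t))\<bar>) \<le> 1 * M"
        using le M0 by (intro mult_mono) (auto intro: sum_nonneg)
      then show ?thesis
        unfolding sum_min_cos_squared[OF m2] by (intro mult_left_mono) auto
    qed
    also have "\<dots> = (\<Sum>j<m. min (r\<^sup>2 * ?cs s j) (r\<^sup>2 * ?cs t j))"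
      by (simp add: sum_distrib_left min_mult_distrib_left)
    also have "\<dots> \<le> (?N x y)\<^sup>2"
      unfolding N using r by (intro sum_mono min.mono mult_right_mono power_mono) auto
    finally have "?L\<^sup>2 * r\<^sup>2 \<le> (?N x y)\<^sup>2" using less by (simp add: mult.commute)
    then have "?L * r \<le> ?N x y"
      unfolding power_mult_distrib[symmetric] by (rule power2_le_imp_le) simp
    then have lower: "?L \<le> ?N x y / r"
      using r by (simp add: pos_le_divide_eq)
    \<comment> \<open>Each minimum is bounded by the term of the vector of norm \<open>r\<close>,
      and the tight frame identity sums these.\<close>
    have "(?N x y)\<^sup>2 \<le> r\<^sup>2 * (real m / 2)"
    proof (cases "r = norm (x + y)")
      case True
      have "(?N x y)\<^sup>2 \<le> (\<Sum>j<m. (norm (x + y))\<^sup>2 * ?cs s j)"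
        unfolding N by (intro sum_mono) simp
      then show ?thesis
        by (simp add: True sum_distrib_left[symmetric] sum_cos_squared[OF m2])
    next
      case False
      then have rd: "r = norm (x - y)" by (auto simp: r_def sgn_dist_def min_def split: if_splits)
      have "(?N x y)\<^sup>2 \<le> (\<Sum>j<m. (norm (x - y))\<^sup>2 * ?cs t j)"
        unfolding N by (intro sum_mono) simp
      then show ?thesis
        by (simp add: rd sum_distrib_left[symmetric] sum_cos_squared[OF m2])
    qed
    then have "(?N x y)\<^sup>2 \<le> (?U * r)\<^sup>2" by (simp add: power_mult_distrib mult.commute)
    then have "?N x y \<le> ?U * r"
      using r by (intro power2_le_imp_le[of "?N x y"]) auto
    then have "?N x y / r \<le> ?U"
      using r by (simp add: pos_divide_le_eq)
    then show ?thesis using lower by (simp add: r_def)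
  qed
  have attained: "\<exists>x y. sgn_dist x y = 1 \<and>
      (?N x y)\<^sup>2 = (\<Sum>j<m. min ((cos (pi * real j / real m - s))\<^sup>2) ((cos (pi * real j / real m - t))\<^sup>2))"
    for s t
  proof -
    define u v :: "real ^ 2" where "u = vector [cos s, sin s]" and "v = vector [cos t, sin t]"
    \<comment> \<open>Solves \<open>x + y = u\<close>, \<open>x - y = v\<close>, so every pair of
      unit vectors is realized.\<close>
    define x y where "x = (1 / 2) *\<^sub>R (u + v)" and "y = (1 / 2) *\<^sub>R (u - v)"
    have xy: "x + y = u" "x - y = v"
      by (simp_all add: x_def y_def vec_eq_iff field_simps)
    have "norm u = 1" "norm v = 1"
      by (simp_all add: u_def v_def norm_vec_def L2_set_def sum_2)
    then have "sgn_dist x y = 1" by (simp add: sgn_dist_def xy)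
    moreover have "(x + y) $ 1 = 1 * cos s" "(x + y) $ 2 = 1 * sin s"
      "(x - y) $ 1 = 1 * cos t" "(x - y) $ 2 = 1 * sin t"
      unfolding xy by (simp_all add: u_def v_def)
    note nsq[OF this]
    ultimately show ?thesis by auto
  qed
  have mem: "sqrt K \<in> pr_ratios ?A" if "sgn_dist x y = 1" "(?N x y)\<^sup>2 = K" for x y K
  proof -
    have "sqrt K = ?N x y / sgn_dist x y" using that by auto
    then show ?thesis unfolding pr_ratios_def using that(1)
      by (intro CollectI exI[of _ x] exI[of _ y]) simp
  qed
  \<comment> \<open>Equal angles make both entries of each minimum agree, giving the full
    \<open>m / 2\<close>.\<close>
  have "?U \<in> pr_ratios ?A"
    using attained[of 0 0] mem sum_cos_squared[OF m2, of 0] by auto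
  then have U: "pr_upper ?A = ?U"
    unfolding pr_upper_def using bounds
    by (intro cSup_eq_maximum) (auto simp: pr_ratios_def)
  \<comment> \<open>Chosen so that \<open>sin (s - t) = 1\<close> while the phase
    \<open>- s - t\<close> is the maximizing \<open>c\<close>.\<close>
  define s t where "s = pi / 4 - c / 2" and "t = - pi / 4 - c / 2"
  have st: "s - t = pi / 2" "- s - t = c"
    by (simp_all add: s_def t_def field_simps)
  have "?L \<in> pr_ratios ?A"
    using attained[of s t] mem unfolding sum_min_cos_squared[OF m2] st eq by auto
  then have L: "pr_lower ?A = ?L"
    unfolding pr_lower_def using bounds
    by (intro cInf_eq_minimum) (auto simp: pr_ratios_def)
  have "?U / ?L = 1 / sqrt (1 - M / real m)"
  proof -
    have "(real m / 2) / ((real m - M) / 2) = 1 / (1 - M / real m)"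
      using m2 less by (simp add: field_simps)
    then show ?thesis by (metis real_sqrt_divide real_sqrt_one)
  qed
  then show ?thesis
    using less by (simp add: cond_number_def U L)
qed

theorem theorem3p3:
  fixes m :: nat and pos :: "'m::finite \<Rightarrow> nat"
  assumes "m \<ge> 3" and "CARD('m) = m" and "bij_betw pos UNIV {1..m}"
  shows "cond_number (harmonic_frame pos) =
    ereal (if even m then 1 / sqrt (1 - 2 / (real m * sin (pi / real m)))
           else 1 / sqrt (1 - 1 / (real m * sin (pi / (2 * real m)))))"
proof (cases "even m")
  case True
  then obtain n where n: "m = 2 * n" by blast
  with assms have n2: "2 \<le> n" by simp
  \<comment> \<open>Here \<open>M\<close> is twice the \<open>n\<close>-point maximum, with half a
    step \<open>pi / (2 * n) = pi / m\<close> as maximizing phase.\<close>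
  have "cond_number (harmonic_frame pos)
      = ereal (1 / sqrt (1 - (2 * (1 / sin (pi / (2 * real n)))) / real m))"
  proof (rule cond_number_harmonic_frame)
    show "(\<Sum>j<m. \<bar>sin (2 * pi * real j / real m + c)\<bar>) \<le> 2 * (1 / sin (pi / (2 * real n)))" for c
      using n2 unfolding n by (subst sum_abs_sin_double_even) (use sum_abs_sin_le[of n c] in simp_all)
    show "(\<Sum>j<m. \<bar>sin (2 * pi * real j / real m + pi / (2 * real n))\<bar>)
        = 2 * (1 / sin (pi / (2 * real n)))"
      using n2 unfolding n by (simp only: sum_abs_sin_double_even sum_abs_sin_midpoints)
    show "2 * (1 / sin (pi / (2 * real n))) < real m"
      using inverse_sin_lt[OF n2] by (simp add: n)
  qed (use assms in auto)
  then show ?thesis using True by (simp add: n mult.commute)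
next
  case False
  \<comment> \<open>Here \<open>M\<close> is the \<open>m\<close>-point maximum, with half a step
    \<open>pi / (2 * m)\<close> as maximizing phase.\<close>
  have "cond_number (harmonic_frame pos)
      = ereal (1 / sqrt (1 - (1 / sin (pi / (2 * real m))) / real m))"
  proof (rule cond_number_harmonic_frame)
    show "(\<Sum>j<m. \<bar>sin (2 * pi * real j / real m + c)\<bar>) \<le> 1 / sin (pi / (2 * real m))" for c
      using assms unfolding sum_abs_sin_double_odd[OF False] by (intro sum_abs_sin_le) simp
    show "(\<Sum>j<m. \<bar>sin (2 * pi * real j / real m + pi / (2 * real m))\<bar>) = 1 / sin (pi / (2 * real m))"
      using assms unfolding sum_abs_sin_double_odd[OF False] by (intro sum_abs_sin_midpoints) simp
    show "1 / sin (pi / (2 * real m)) < real m"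
      using assms by (intro inverse_sin_lt) simp
  qed (use assms in auto)
  then show ?thesis using False by (simp add: mult.commute)
qed

end
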